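(* Let $K$ be an algebraically closed field of characteristic zero, and let $(x,M,N,d) \in K \times \mathbb{Z}^3$ with $M \ge 0$, $N \ge 1$, and $d \ge 2$. For $c\in K$ put $f_{d,c}(z) := z^d + c \in K[z]$. Then there exists $c \in K$ for which $x$ has portrait $(M,N)$ under $f_{d,c}$ if and only if $$(x,M) \ne (0,1) \quad\text{and}\quad (x,M,N,d) \notin \left\{ \left(-\tfrac{1}{2},0,2,2 \right), \left(\tfrac{1}{2}, 1, 2, 2 \right), \left( 1, 2, 2, 2 \right), \left( -1, 2, 2, 2 \right) \right\}.$$
   Context: For a polynomial $\phi \in K[z]$ of degree at least $2$, $\phi^n$ denotes the $n$-fold composition of $\phi$ ($\phi^0$ is the identity map, $\phi^n = \phi\circ\phi^{n-1}$). A point $x \in K$ is preperiodic for $\phi$ if there exist integers $M \ge 0$, $N \ge 1$ with $\phi^{M+N}(x) = \phi^M(x)$; the minimal such $M$ is the preperiod of $x$ and the minimal such $N$ is the eventual period of $x$. The point $x$ has portrait $(M,N)$ under $\phi$ if it is preperiodic with preperiod exactly $M$ and eventual period exactly $N$. *)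

theory Defs
  imports Complex_Main "HOL-Computational_Algebra.Polynomial"
begin

definition preperiodic :: "'a::comm_semiring_0 poly \<Rightarrow> 'a \<Rightarrow> bool" where
  "preperiodic \<phi> x \<longleftrightarrow>
     (\<exists>M N. N \<ge> 1 \<and> (poly \<phi> ^^ (M + N)) x = (poly \<phi> ^^ M) x)"

text \<open>
  The values of \<open>preperiod\<close> and \<open>eventual_period\<close> are meaningful only at preperiodic
  points; \<open>LEAST\<close> is unspecified otherwise.
\<close>

definition preperiod :: "'a::comm_semiring_0 poly \<Rightarrow> 'a \<Rightarrow> nat" where
  "preperiod \<phi> x =
     (LEAST M. \<exists>N\<ge>1. (poly \<phi> ^^ (M + N)) x = (poly \<phi> ^^ M) x)"

definition eventual_period :: "'a::comm_semiring_0 poly \<Rightarrow> 'a \<Rightarrow> nat" where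
  "eventual_period \<phi> x =
     (LEAST N. N \<ge> 1 \<and> (\<exists>M. (poly \<phi> ^^ (M + N)) x = (poly \<phi> ^^ M) x))"

definition has_portrait :: "'a::comm_semiring_0 poly \<Rightarrow> 'a \<Rightarrow> nat \<Rightarrow> nat \<Rightarrow> bool" where
  "has_portrait \<phi> x M N \<longleftrightarrow>
     preperiodic \<phi> x \<and> preperiod \<phi> x = M \<and> eventual_period \<phi> x = N"

definition unicritical :: "nat \<Rightarrow> 'a::comm_semiring_1 \<Rightarrow> 'a poly" where
  "unicritical d c = monom 1 d + [:c:]"

end

theory Submission
  imports Defs
begin

text \<open>
  Fix \<open>x\<close> and let \<open>P\<^sub>n(c)\<close> be the \<open>n\<close>-th iterate of \<open>x\<close> under \<open>z\<^sup>d + c\<close>, viewed as a polynomial in the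
  parameter \<open>c\<close>; for \<open>n \<ge> 1\<close> its degree is \<open>d\<close> to the power \<open>n - 1\<close>. Realizing a portrait means finding a
  root of one such polynomial equation that is not a root of certain others.

  For \<open>M = 0\<close> the equation is \<open>P\<^sub>N = x\<close>. For \<open>M = m + 1\<close>, the points \<open>P\<^sub>m(c)\<close> and \<open>P\<^bsub>m+N\<^esub>(c)\<close> must be
  distinct with the same image, that is \<open>P\<^bsub>m+N\<^esub>(c) = \<zeta> P\<^sub>m(c) \<noteq> 0\<close> for some \<open>\<zeta> \<noteq> 1\<close> with \<open>\<zeta>\<^sup>d = 1\<close>; the case
  \<open>M = 0\<close> fits the same pattern with \<open>m = 0\<close> and \<open>\<zeta> = 1\<close>. A root is bad if the period drops to a proper
  divisor \<open>n\<close> of \<open>N\<close>, in which case \<open>n \<le> N div 2\<close> and the root also solves \<open>P\<^bsub>m+n\<^esub> = \<zeta> P\<^sub>m\<close>, or if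
  \<open>P\<^sub>m(c) = 0\<close>. The degrees bound the number of bad roots, so it suffices that \<open>P\<^bsub>m+N\<^esub> - \<zeta> P\<^sub>m\<close> has
  enough distinct roots.

  Such a lower bound comes from the argument of the Mason--Stothers theorem. The polynomial has the form
  \<open>A\<^sup>d + S\<close> with \<open>A = P\<^bsub>m+N-1\<^esub>\<close> and \<open>S = c - \<zeta> P\<^sub>m\<close> of small degree, and a polynomial of this form cannot
  have many multiple roots (\<open>card_roots_power_add_ge\<close>). Comparing the two counts gives a good parameter
  whenever \<open>d \<ge> 3\<close> or \<open>N \<ge> 3\<close> (\<open>exists_parameter\<close>).

  What remains is \<open>d = 2\<close> with \<open>N \<in> {1, 2}\<close>. For \<open>N = 1\<close> the equation is linear in \<open>c\<close> if \<open>m = 0\<close>;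
  if \<open>m \<ge> 1\<close>, a root is bad only if \<open>c = x = 0\<close>, and then it is a simple root, so another one exists
  (\<open>exists_parameter_quadratic_fixed\<close>). For \<open>N = 2\<close> the equation factors. The factor that excludes fixed
  points is \<open>c + x\<^sup>2 + x + 1\<close> for \<open>M = 0\<close>, and \<open>P\<^bsub>m+1\<^esub> - P\<^sub>m + 1\<close> for \<open>M = m + 1\<close>. In the latter case its
  bad roots lie in \<open>{-1, -3/4}\<close> (\<open>exists_parameter_quadratic_two_cycle\<close>). All roots are bad only if
  \<open>(x, M) = (0, 1)\<close> or \<open>(x, M)\<close> is in the exceptional list. In the exceptional cases the orbit of \<open>x\<close>
  degenerates: for \<open>x = \<plusminus>1/2\<close> the only candidate is \<open>c = -3/4\<close>, where the \<open>2\<close>-cycle has collapsed to a fixed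
  point, and for \<open>x = \<plusminus>1\<close> it is \<open>c = -1\<close>, where \<open>x\<close> is mapped to the critical point \<open>0\<close>, which is itself
  periodic. Finally, \<open>0\<close> never has preperiod \<open>1\<close>, because it is the only preimage of its image.
\<close>

section \<open>Counting distinct roots\<close>

lemma sum_order_eq_degree:
  fixes p :: "'a::alg_closed_field poly"
  assumes "p \<noteq> 0"
  shows "(\<Sum>z | poly p z = 0. order z p) = degree p"
proof -
  obtain A where A: "size A = degree p" "p = smult (lead_coeff p) (\<Prod>z\<in>#A. [:-z, 1:])"
    using alg_closed_imp_factorization[OF assms] by blast
  have lc: "lead_coeff p \<noteq> 0" using assms by simp
  have "proots (\<Prod>z\<in>#A. [:-z, 1:]) = A"
  proof (induction A)
    case (add z A)
    have "(\<Prod>z\<in>#A. [:-z, 1:]) \<noteq> 0" by auto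
    then have "proots ([:-z, 1:] * (\<Prod>z\<in>#A. [:-z, 1:])) = {#z#} + A"
      by (subst proots_mult) (auto simp: add.IH simp del: mult_pCons_left)
    then show ?case by simp
  qed simp
  then have "proots p = A" using lc by (subst A(2)) simp
  then have "size (proots p) = degree p" using A(1) by simp
  then show ?thesis using assms by (simp add: size_multiset_overloaded_eq)
qed

text \<open>
  The multiplicities of the roots of \<open>R\<close>, each reduced by one, are absorbed by the roots of \<open>V\<close>.
\<close>
lemma degree_le_card_roots_plus_degree:
  fixes R V :: "'a::alg_closed_field poly"
  assumes "R \<noteq> 0" "V \<noteq> 0"
    and ord: "\<And>z. poly R z = 0 \<Longrightarrow> order z R \<le> Suc (order z V)"
  shows "degree R \<le> card {z. poly R z = 0} + degree V"
proof -
  have fin: "finite {z. poly R z = 0}" "finite {z. poly V z = 0}"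
    using assms poly_roots_finite by auto
  have "degree R = (\<Sum>z | poly R z = 0. order z R)"
    using assms by (simp add: sum_order_eq_degree)
  also have "\<dots> \<le> (\<Sum>z | poly R z = 0. Suc (order z V))"
    using ord by (intro sum_mono) auto
  also have "\<dots> = card {z. poly R z = 0} + (\<Sum>z | poly R z = 0. order z V)"
    using sum.distrib[of "\<lambda>_. 1" "\<lambda>z. order z V" "{z. poly R z = 0}"] by simp
  also have "(\<Sum>z | poly R z = 0. order z V) = (\<Sum>z | poly R z = 0 \<and> poly V z = 0. order z V)"
    using fin by (intro sum.mono_neutral_right) (auto simp: order_root)
  also have "\<dots> \<le> (\<Sum>z | poly V z = 0. order z V)"
    using fin by (intro sum_mono2) auto
  also have "\<dots> \<le> degree V" using assms by (simp add: sum_order_le_degree)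
  finally show ?thesis by simp
qed

lemma lead_coeff_pderiv:
  fixes p :: "'a::{idom,semiring_char_0} poly"
  shows "lead_coeff (pderiv p) = of_nat (degree p) * lead_coeff p"
  by (cases "degree p") (auto simp: degree_pderiv coeff_pderiv coeff_eq_0)

text \<open>
  With \<open>R = A\<^sup>d + S\<close>, put \<open>V = d S A' - S' A\<close>. Replacing \<open>S\<close> by \<open>R\<close> does not change \<open>V\<close>, since the
  contribution of \<open>A\<^sup>d\<close> cancels. Hence every multiple root of \<open>R\<close>, being a root of \<open>R\<close> and \<open>R'\<close>, is
  a root of \<open>V\<close> with multiplicity at most one less, while the degree of \<open>V\<close> is small. This is the
  Mason--Stothers argument with a perfect power as one summand: \<open>V\<close> is, up to sign, the Wronskian of
  \<open>A\<^sup>d\<close> and \<open>S\<close> divided by the power of \<open>A\<close> with exponent \<open>d - 1\<close>.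
\<close>
lemma card_roots_power_add_ge:
  fixes A S :: "'a::{alg_closed_field, field_char_0} poly"
  assumes "S \<noteq> 0" "degree A > 0" "degree S < d * degree A"
  shows "d * degree A + 1 \<le> card {z. poly (A ^ d + S) z = 0} + degree S + degree A"
proof -
  define R where "R = A ^ d + S"
  define V where "V = smult (of_nat d) (S * pderiv A) - pderiv S * A"
  have d0: "d > 0" using assms by (cases d) auto
  have A0: "A \<noteq> 0" using assms by auto
  have degR: "degree R = d * degree A"
    unfolding R_def using assms by (subst degree_add_eq_left) (auto simp: degree_power_eq A0)
  have R0: "R \<noteq> 0" using degR assms d0 by auto
  have V_R: "V = smult (of_nat d) (R * pderiv A) - pderiv R * A"
  proof -
    obtain e where "d = Suc e" using d0 by (cases d) auto
    then have "pderiv (A ^ d) = smult (of_nat d) (A ^ e * pderiv A)" "A ^ d = A * A ^ e"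
      by (simp_all add: pderiv_power_Suc del: power_Suc of_nat_Suc) simp
    then show ?thesis
      by (simp add: V_def R_def pderiv_add algebra_simps smult_add_right)
  qed
  \<comment> \<open>If \<open>V\<close> vanished, comparing leading coefficients would give \<open>degree S = d * degree A\<close>.\<close>
  have V0: "V \<noteq> 0"
  proof
    assume "V = 0"
    then have eq: "smult (of_nat d) (S * pderiv A) = pderiv S * A" by (simp add: V_def)
    have "lead_coeff (smult (of_nat d) (S * pderiv A)) = of_nat (d * degree A) * (lead_coeff S * lead_coeff A)"
      by (simp add: lead_coeff_mult lead_coeff_pderiv)
    moreover have "lead_coeff (pderiv S * A) = of_nat (degree S) * (lead_coeff S * lead_coeff A)"
      by (simp only: lead_coeff_mult lead_coeff_pderiv mult.assoc)
    ultimately have "(of_nat (d * degree A) :: 'a) = of_nat (degree S)"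
      using eq assms A0 by auto
    then show False using assms by (simp only: of_nat_eq_iff)
  qed
  have degV: "degree V \<le> degree S + degree A - 1"
  proof -
    have "degree (smult (of_nat d) (S * pderiv A)) \<le> degree S + degree A - 1"
      using degree_mult_le[of S "pderiv A"] assms by (auto simp: degree_pderiv)
    moreover have "degree (pderiv S * A) \<le> degree S + degree A - 1"
    proof (cases "degree S = 0")
      case False then show ?thesis using degree_mult_le[of "pderiv S" A] by (auto simp: degree_pderiv)
    qed (simp add: pderiv_eq_0_iff[THEN iffD2])
    ultimately show ?thesis unfolding V_def by (rule degree_diff_le)
  qed
  have "order z R \<le> Suc (order z V)" if z: "poly R z = 0" for z
  proof -
    define k where "k = order z (pderiv R)"
    have k: "order z R = Suc k" using order_pderiv[OF R0 z] by (simp add: k_def)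
    have "[:-z, 1:] ^ k dvd R" by (subst order_divides) (simp add: k)
    moreover have "[:-z, 1:] ^ k dvd pderiv R" by (simp add: order_divides k_def)
    ultimately have "[:-z, 1:] ^ k dvd V" by (simp add: V_R dvd_diff dvd_mult2 dvd_smult)
    then show ?thesis using V0 by (simp add: order_divides k)
  qed
  then have "degree R \<le> card {z. poly R z = 0} + degree V"
    by (intro degree_le_card_roots_plus_degree R0 V0)
  then show ?thesis using degV degR assms(2) unfolding R_def by linarith
qed

lemma exists_root_avoiding:
  fixes R :: "'a::{comm_ring_1,ring_no_zero_divisors} poly" and Q :: "'i \<Rightarrow> 'a poly"
  assumes "finite I" "\<And>i. i \<in> I \<Longrightarrow> Q i \<noteq> 0" "R \<noteq> 0"
    and "(\<Sum>i\<in>I. degree (Q i)) < card {z. poly R z = 0}"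
  shows "\<exists>z. poly R z = 0 \<and> (\<forall>i\<in>I. poly (Q i) z \<noteq> 0)"
proof (rule ccontr)
  assume "\<not> ?thesis"
  then have ex: "\<exists>i\<in>I. poly (Q i) z = 0" if "poly R z = 0" for z
    using that by blast
  have sub: "{z. poly R z = 0} \<subseteq> (\<Union>i\<in>I. {z. poly (Q i) z = 0})"
  proof
    fix z assume "z \<in> {z. poly R z = 0}"
    then have "poly R z = 0" by simp
    from ex[OF this] show "z \<in> (\<Union>i\<in>I. {z. poly (Q i) z = 0})" by simp
  qed
  have "card {z. poly R z = 0} \<le> card (\<Union>i\<in>I. {z. poly (Q i) z = 0})"
    using assms sub by (intro card_mono) (auto simp: poly_roots_finite)
  also have "\<dots> \<le> (\<Sum>i\<in>I. card {z. poly (Q i) z = 0})"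
    using assms by (intro card_UN_le) auto
  also have "\<dots> \<le> (\<Sum>i\<in>I. degree (Q i))"
    using assms by (intro sum_mono card_poly_roots_bound) auto
  finally show False using assms by simp
qed

section \<open>Portraits as coincidences between iterates\<close>

lemma funpow_periodic_shift:
  fixes f :: "'a \<Rightarrow> 'a"
  assumes "(f ^^ (m + n)) x = (f ^^ m) x" "m \<le> j"
  shows "(f ^^ (j + k * n)) x = (f ^^ j) x"
proof -
  have step: "(f ^^ (j + n)) x = (f ^^ j) x" if "m \<le> j" for j
  proof -
    have "(f ^^ (j + n)) x = (f ^^ ((j - m) + (m + n))) x" using that by simp
    also have "\<dots> = (f ^^ ((j - m) + m)) x"
      by (metis assms(1) funpow_add o_apply)
    finally show ?thesis using that by simp
  qed
  show ?thesis
  proof (induction k)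
    case (Suc k)
    then show ?case using step[of "j + k * n"] assms(2) by (simp add: add_ac)
  qed simp
qed

text \<open>
  The exact period is a divisor of every period, so a period smaller than \<open>N\<close> can be taken to be a
  divisor of \<open>N\<close> that is at most \<open>N div 2\<close>. Restricting the conditions to this range is
  what keeps the number of parameters to be avoided small when \<open>d = 2\<close>.
\<close>
lemma has_portraitI:
  assumes N: "N \<ge> 1"
    and per: "(poly \<phi> ^^ (M + N)) x = (poly \<phi> ^^ M) x"
    and small: "\<And>n. 1 \<le> n \<Longrightarrow> n \<le> N div 2 \<Longrightarrow> n dvd N \<Longrightarrow> (poly \<phi> ^^ (M + n)) x \<noteq> (poly \<phi> ^^ M) x"
    and pre: "\<And>m. M = Suc m \<Longrightarrow> (poly \<phi> ^^ (m + N)) x \<noteq> (poly \<phi> ^^ m) x"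
  shows "has_portrait \<phi> x M N"
proof -
  let ?f = "poly \<phi>"
  \<comment> \<open>If \<open>f\<^sup>m(x)\<close> were periodic for some \<open>m < M\<close>, then so would be the last point before \<open>f\<^sup>M(x)\<close>.\<close>
  have minM: "M \<le> m" if "n \<ge> 1" "(?f ^^ (m + n)) x = (?f ^^ m) x" for m n
  proof (rule ccontr)
    assume "\<not> M \<le> m"
    then obtain k where k: "M = Suc k" "m \<le> k" by (cases M) auto
    have "k + N * n = k + N + (n - 1) * N" using that(1) by (cases n) (auto simp: algebra_simps)
    moreover have "(?f ^^ (k + N + (n - 1) * N)) x = (?f ^^ (k + N)) x"
      using funpow_periodic_shift[OF per] k N by simp
    moreover have "(?f ^^ (k + N * n)) x = (?f ^^ k) x"
      using funpow_periodic_shift[OF that(2)] k by simp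
    ultimately show False using pre k by metis
  qed
  \<comment> \<open>The exact period \<open>p\<close> of \<open>f\<^sup>M(x)\<close> divides \<open>N\<close>, so it is \<open>N\<close> or at most \<open>N div 2\<close>.\<close>
  define P where "P n \<longleftrightarrow> n \<ge> 1 \<and> (?f ^^ (M + n)) x = (?f ^^ M) x" for n
  define p where "p = (LEAST n. P n)"
  have "P N" using N per by (simp add: P_def)
  then have p: "P p" "p \<le> N" unfolding p_def by (auto intro: LeastI Least_le)
  have "N mod p = 0"
  proof (rule ccontr)
    assume nz: "N mod p \<noteq> 0"
    have "M + N = M + N mod p + (N div p) * p" by simp
    moreover have "(?f ^^ (M + N mod p + (N div p) * p)) x = (?f ^^ (M + N mod p)) x"
      using p by (intro funpow_periodic_shift[of M]) (auto simp: P_def)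
    ultimately have "P (N mod p)" using nz per by (metis One_nat_def P_def Suc_leI neq0_conv)
    then have "p \<le> N mod p" unfolding p_def by (rule Least_le)
    then show False using p by (metis P_def mod_less_divisor not_less not_one_le_zero zero_less_iff_neq_zero)
  qed
  then have dvd: "p dvd N" by auto
  have pN: "p = N"
  proof (rule ccontr)
    assume "p \<noteq> N"
    obtain k where k: "N = p * k" using dvd by (elim dvdE)
    with \<open>p \<noteq> N\<close> N have "k \<ge> 2" by (cases k; cases "k - 1") auto
    then have "p * 2 \<le> N" using k by simp
    then have "p \<le> N div 2" by simp
    then show False using small[of p] dvd p(1) by (auto simp: P_def)
  qed
  have minN: "N \<le> n" if n: "n \<ge> 1" "(?f ^^ (m + n)) x = (?f ^^ m) x" for m n
  proof -
    have a: "(?f ^^ (M + m * N + 1 * n)) x = (?f ^^ (M + m * N)) x"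
      using N by (intro funpow_periodic_shift[OF n(2)]) (simp add: trans_le_add2)
    have b: "(?f ^^ (M + m * N)) x = (?f ^^ M) x" by (rule funpow_periodic_shift[OF per]) simp
    have "(?f ^^ (M + n + m * N)) x = (?f ^^ (M + n)) x" by (rule funpow_periodic_shift[OF per]) simp
    then have "P n" using a b n by (simp add: P_def add.assoc add.commute add.left_commute)
    then show ?thesis using pN p_def by (metis Least_le)
  qed
  have "preperiod \<phi> x = M"
    unfolding preperiod_def using per N minM by (intro Least_equality) blast+
  moreover have "eventual_period \<phi> x = N"
    unfolding eventual_period_def using per N minN by (intro Least_equality) blast+
  ultimately show ?thesis using per N by (auto simp: has_portrait_def preperiodic_def)
qed

text \<open>
  Preperiod and eventual period are minimized independently of each other in the definition; the
  point is that the two minima are attained by the same coincidence.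
\<close>
lemma has_portraitD:
  assumes "has_portrait \<phi> x M N"
  shows "(poly \<phi> ^^ (M + N)) x = (poly \<phi> ^^ M) x"
    and "\<And>m n. n \<ge> 1 \<Longrightarrow> (poly \<phi> ^^ (m + n)) x = (poly \<phi> ^^ m) x \<Longrightarrow> M \<le> m \<and> N \<le> n"
proof -
  let ?f = "poly \<phi>"
  have ex: "\<exists>M N. N \<ge> 1 \<and> (?f ^^ (M + N)) x = (?f ^^ M) x"
    using assms by (simp add: has_portrait_def preperiodic_def)
  have M: "M = (LEAST M. \<exists>N\<ge>1. (?f ^^ (M + N)) x = (?f ^^ M) x)"
    using assms unfolding has_portrait_def preperiod_def by (elim conjE) (rule sym)
  have N: "N = (LEAST N. N \<ge> 1 \<and> (\<exists>M. (?f ^^ (M + N)) x = (?f ^^ M) x))"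
    using assms unfolding has_portrait_def eventual_period_def by (elim conjE) (rule sym)
  have "\<exists>N\<ge>1. (?f ^^ (M + N)) x = (?f ^^ M) x"
    using LeastI_ex[of "\<lambda>M. \<exists>N\<ge>1. (?f ^^ (M + N)) x = (?f ^^ M) x"] ex
    unfolding M[symmetric] by blast
  then obtain k where k: "k \<ge> 1" "(?f ^^ (M + k)) x = (?f ^^ M) x" by blast
  have "\<exists>M. (?f ^^ (M + N)) x = (?f ^^ M) x"
    using LeastI_ex[of "\<lambda>N. N \<ge> 1 \<and> (\<exists>M. (?f ^^ (M + N)) x = (?f ^^ M) x)"] ex
    unfolding N[symmetric] by blast
  then obtain m where m: "(?f ^^ (m + N)) x = (?f ^^ m) x" by blast
  have "(?f ^^ (M + m * k + 1 * N)) x = (?f ^^ (M + m * k)) x"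
    using k by (intro funpow_periodic_shift[OF m]) (simp add: trans_le_add2)
  moreover have "(?f ^^ (M + m * k)) x = (?f ^^ M) x" by (rule funpow_periodic_shift[OF k(2)]) simp
  moreover have "(?f ^^ (M + N + m * k)) x = (?f ^^ (M + N)) x" by (rule funpow_periodic_shift[OF k(2)]) simp
  ultimately show "(?f ^^ (M + N)) x = (?f ^^ M) x" by (simp add: add.assoc add.commute add.left_commute)
  show "M \<le> m \<and> N \<le> n" if "n \<ge> 1" "(?f ^^ (m + n)) x = (?f ^^ m) x" for m n
    using that Least_le[of "\<lambda>M. \<exists>N\<ge>1. (?f ^^ (M + N)) x = (?f ^^ M) x" m]
      Least_le[of "\<lambda>N. N \<ge> 1 \<and> (\<exists>M. (?f ^^ (M + N)) x = (?f ^^ M) x)" n]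
    unfolding M[symmetric] N[symmetric] by blast
qed

section \<open>Orbits as polynomials in the parameter\<close>

text \<open>
  The indeterminate is the parameter \<open>c\<close>, not the dynamical variable \<open>z\<close>.
\<close>
primrec orbit_poly :: "nat \<Rightarrow> 'a::comm_ring_1 \<Rightarrow> nat \<Rightarrow> 'a poly" where
  "orbit_poly d x 0 = [:x:]"
| "orbit_poly d x (Suc n) = orbit_poly d x n ^ d + [:0, 1:]"

lemma poly_unicritical: "poly (unicritical d c) z = z ^ d + c"
  by (simp add: unicritical_def poly_monom)

lemma poly_orbit_poly: "poly (orbit_poly d x n) c = (poly (unicritical d c) ^^ n) x"
  by (induction n) (simp_all add: poly_unicritical)

lemma orbit_poly_1: "orbit_poly d x (Suc 0) = [:x ^ d, 1:]"
  by (simp add: poly_const_pow)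

lemma degree_orbit_poly_Suc:
  fixes x :: "'a::idom"
  assumes "d \<ge> 2"
  shows "degree (orbit_poly d x (Suc n)) = d ^ n"
proof (induction n)
  case 0
  show ?case unfolding orbit_poly_1 by simp
next
  case (Suc n)
  have nz: "orbit_poly d x (Suc n) \<noteq> 0" using Suc assms by auto
  have "degree (orbit_poly d x (Suc n) ^ d) = d ^ Suc n"
    using degree_power_eq[OF nz, of d] Suc by (simp del: orbit_poly.simps)
  moreover have "(1::nat) < d ^ Suc n" using assms by (intro one_less_power) auto
  ultimately show ?case
    by (subst orbit_poly.simps(2), subst degree_add_eq_left) auto
qed

lemma degree_orbit_poly:
  fixes x :: "'a::idom"
  assumes "d \<ge> 2" "n \<ge> 1"
  shows "degree (orbit_poly d x n) = d ^ (n - 1)"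
  using degree_orbit_poly_Suc[OF assms(1), of x "n - 1"] assms(2) by simp

lemma degree_orbit_poly_diff:
  fixes x :: "'a::idom"
  assumes "d \<ge> 2" "n \<ge> 1"
  shows "degree (orbit_poly d x (m + n) - smult \<zeta> (orbit_poly d x m)) = d ^ (m + n - 1)"
proof -
  have "degree (smult \<zeta> (orbit_poly d x m)) < degree (orbit_poly d x (m + n))"
  proof (cases m)
    case 0
    then show ?thesis using assms by (simp add: degree_orbit_poly)
  next
    case (Suc l)
    have "degree (smult \<zeta> (orbit_poly d x m)) \<le> d ^ l"
      using degree_smult_le[of \<zeta> "orbit_poly d x m"] assms by (simp add: Suc degree_orbit_poly_Suc del: orbit_poly.simps)
    also have "\<dots> < d ^ (m + n - 1)" using assms Suc by (intro power_strict_increasing) auto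
    finally show ?thesis using assms by (simp add: degree_orbit_poly)
  qed
  then show ?thesis using assms
    by (simp only: diff_conv_add_uminus degree_add_eq_left degree_minus) (simp add: degree_orbit_poly)
qed

text \<open>
  The polynomial is \<open>A\<^sup>d + S\<close> with \<open>A = P\<^bsub>m+N-1\<^esub>\<close> and \<open>S = c - \<zeta> P\<^sub>m\<close>. The condition on \<open>\<zeta>\<close> prevents \<open>S\<close>
  from vanishing, which happens for \<open>m = 1\<close>, \<open>\<zeta> = 1\<close>, \<open>x = 0\<close>. The truncated subtraction in \<open>d ^ (m - 1)\<close>
  is intended: for \<open>m = 0\<close> and \<open>m = 1\<close> alike, \<open>S\<close> has degree at most \<open>1\<close>.
\<close>
lemma card_coincidence_parameters:
  fixes x :: "'a::{alg_closed_field, field_char_0}"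
  assumes d: "d \<ge> 2" and N: "N \<ge> 1" and mN: "m + N \<ge> 2"
    and \<zeta>: "\<zeta> \<noteq> 0" "m = 0 \<or> \<zeta> \<noteq> 1"
  shows "d ^ (m + N - 1) + 1 \<le>
    card {c. poly (orbit_poly d x (m + N) - smult \<zeta> (orbit_poly d x m)) c = 0}
      + d ^ (m - 1) + d ^ (m + N - 2)"
proof -
  define A where "A = orbit_poly d x (m + N - 1)"
  define S where "S = [:0, 1:] - smult \<zeta> (orbit_poly d x m)"
  have degA: "degree A = d ^ (m + N - 2)"
    unfolding A_def using d mN by (subst degree_orbit_poly) (auto simp: numeral_2_eq_2)
  have dA: "d * degree A = d ^ (m + N - 1)"
  proof -
    have "m + N - 1 = Suc (m + N - 2)" using mN by simp
    then show ?thesis by (simp only: degA power_Suc)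
  qed
  have S: "S \<noteq> 0" "degree S \<le> d ^ (m - 1)"
  proof -
    have "m \<ge> 2 \<Longrightarrow> m = Suc (Suc (m - 2))" by simp
    then consider "m = 0" | "m = 1" | l where "m = Suc (Suc l)"
      by (cases "m \<ge> 2") force+
    then have "S \<noteq> 0 \<and> degree S \<le> d ^ (m - 1)"
    proof cases
      case 1
      then show ?thesis by (simp add: S_def)
    next
      case 2
      then have "S = [:- \<zeta> * x ^ d, 1 - \<zeta>:]" by (simp add: S_def poly_const_pow)
      then show ?thesis using \<zeta> 2 by auto
    next
      case 3
      have deg: "degree (smult \<zeta> (orbit_poly d x m)) = d ^ Suc l"
        using degree_orbit_poly_Suc[OF d, of x "Suc l"] \<zeta> 3 by (simp del: orbit_poly.simps)
      have "1 < d ^ Suc l" using d by (intro one_less_power) auto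
      then have "degree S = d ^ Suc l"
        unfolding S_def using deg
        by (simp only: diff_conv_add_uminus) (subst degree_add_eq_right, auto)
      then show ?thesis using \<open>1 < d ^ Suc l\<close> 3 by auto
    qed
    then show "S \<noteq> 0" "degree S \<le> d ^ (m - 1)" by auto
  qed
  have "d ^ (m - 1) < d ^ (m + N - 1)"
    using d N mN by (intro power_strict_increasing) auto
  then have "degree S < d * degree A" using S(2) dA by linarith
  then have "d * degree A + 1 \<le> card {c. poly (A ^ d + S) c = 0} + degree S + degree A"
    using S(1) d by (intro card_roots_power_add_ge) (auto simp: degA)
  moreover have "m + N = Suc (m + N - 1)" using N by simp
  then have "A ^ d + S = orbit_poly d x (m + N) - smult \<zeta> (orbit_poly d x m)"
    unfolding A_def S_def using orbit_poly.simps(2)[of d x "m + N - 1"] by (simp only: add_diff_eq)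
  ultimately show ?thesis using S dA degA by simp
qed

section \<open>Parameters for degree at least three or period at least three\<close>

text \<open>
  The numerical comparison behind the count: up to a common power of \<open>d\<close>, the right-hand side is the
  main term of the number of distinct roots. The sum counts the roots at which the period drops; the
  summand \<open>2\<close> covers the loss from the degree of \<open>S\<close> and the roots with \<open>P\<^sub>m(c) = 0\<close>.
  The bound fails for \<open>d = 2\<close> and \<open>N \<le> 2\<close>.
\<close>
lemma sum_powers_le:
  fixes d :: nat
  assumes "d \<ge> 2" "N \<ge> 1" "d \<ge> 3 \<or> N \<ge> 3"
  shows "2 + (\<Sum>n=1..N div 2. d ^ n) \<le> (d - 1) * d ^ (N - 1)"
proof -
  have geo: "2 + (\<Sum>n=1..h. d ^ n) \<le> 2 * d ^ h" for h
  proof (induction h)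
    case (Suc h)
    have "2 * d ^ h \<le> d * d ^ h" using assms by simp
    moreover have "(\<Sum>n=1..Suc h. d ^ n) = (\<Sum>n=1..h. d ^ n) + d * d ^ h" by simp
    ultimately show ?case using Suc.IH unfolding power_Suc by linarith
  qed simp
  consider "N \<ge> 3" | "N = 1" "d \<ge> 3" | "N = 2" "d \<ge> 3" using assms by linarith
  then show ?thesis
  proof cases
    case 1
    have "2 * d ^ (N div 2) \<le> 2 * d ^ (N - 2)"
      using 1 assms by (intro mult_left_mono power_increasing) auto
    also have "\<dots> \<le> d * d ^ (N - 2)" using assms by simp
    also have "\<dots> = d ^ (N - 1)"
    proof -
      have "N - 1 = Suc (N - 2)" using 1 by simp
      then show ?thesis by (simp only: power_Suc)
    qed
    also have "\<dots> \<le> (d - 1) * d ^ (N - 1)" using assms by simp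
    finally show ?thesis using geo[of "N div 2"] by linarith
  next
    case 3
    have "2 * d \<le> (d - 1) * d" using 3 by (intro mult_right_mono) auto
    then have "2 + d \<le> (d - 1) * d" using 3 by linarith
    then show ?thesis using 3 by simp
  qed auto
qed

text \<open>
  More distinct roots than the polynomials to be avoided can have together. Index \<open>0\<close> of the family
  \<open>Q\<close> in the proof stands for the condition \<open>P\<^sub>m(c) \<noteq> 0\<close>; for \<open>m = 0\<close> that value is the constant \<open>x\<close>, and
  \<open>Q 0 = 1\<close> imposes nothing.
\<close>
lemma exists_parameter:
  fixes x :: "'a::{alg_closed_field, field_char_0}"
  assumes d: "d \<ge> 2" and N: "N \<ge> 1" and dN: "d \<ge> 3 \<or> N \<ge> 3 \<or> m = 0 \<and> N = 1"
    and \<zeta>: "\<zeta> \<noteq> 0" "m = 0 \<or> \<zeta> \<noteq> 1"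
  shows "\<exists>c. poly (orbit_poly d x (m + N)) c = \<zeta> * poly (orbit_poly d x m) c
    \<and> (m \<ge> 1 \<longrightarrow> poly (orbit_poly d x m) c \<noteq> 0)
    \<and> (\<forall>n\<in>{1..N div 2}. poly (orbit_poly d x (m + n)) c \<noteq> \<zeta> * poly (orbit_poly d x m) c)"
proof (cases "m = 0 \<and> N = 1")
  case True
  have "poly (orbit_poly d x (m + N)) (\<zeta> * x - x ^ d) = \<zeta> * poly (orbit_poly d x m) (\<zeta> * x - x ^ d)"
    using True by simp
  then show ?thesis using True by (intro exI[of _ "\<zeta> * x - x ^ d"]) simp
next
  case False
  define h where "h = N div 2"
  define R where "R n = orbit_poly d x (m + n) - smult \<zeta> (orbit_poly d x m)" for n
  define Q where "Q n = (if n = 0 then if m = 0 then 1 else orbit_poly d x m else R n)" for n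
  define k where "k = card {c. poly (R N) c = 0}"
  define D where "D = (\<Sum>n=1..h. d ^ n)"
  have degR: "degree (R n) = d ^ (m + n - 1)" if "n \<ge> 1" for n
    unfolding R_def using d that by (rule degree_orbit_poly_diff)
  have R0: "R n \<noteq> 0" if "n \<ge> 1" for n
    using degR[OF that] d by auto
  have "(\<Sum>i\<in>{0..h}. degree (Q i)) < k"
  proof -
    have sum: "(\<Sum>i\<in>{0..h}. degree (Q i)) = degree (Q 0) + (\<Sum>n=1..h. d ^ (m + n - 1))"
      by (simp add: sum.atLeast_Suc_atMost[of 0] Q_def degR)
    have num: "2 + D \<le> (d - 1) * d ^ (N - 1)"
      unfolding D_def h_def using d N dN False by (intro sum_powers_le) auto
    have cnt: "d ^ (m + N - 1) + 1 \<le> k + d ^ (m - 1) + d ^ (m + N - 2)"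
      unfolding k_def R_def using d N \<zeta> False by (intro card_coincidence_parameters) auto
    show ?thesis
    proof (cases m)
      case 0
      then have "N = Suc (Suc (N - 2))" using False N by simp
      then obtain j where j: "N = Suc (Suc j)" ..
      define E where "E = (\<Sum>n=1..h. d ^ (n - 1))"
      have "D = d * E"
        unfolding D_def E_def sum_distrib_left by (intro sum.cong) (auto simp flip: power_Suc)
      then have "d * E < d * ((d - 1) * d ^ j)" using num j by (simp add: algebra_simps)
      then have "E < (d - 1) * d ^ j" by simp
      moreover have "d * d ^ j \<le> k + d ^ j" using cnt 0 j by simp
      moreover have "d * d ^ j = (d - 1) * d ^ j + d ^ j" using d by (simp add: algebra_simps)
      ultimately show ?thesis using sum 0 by (simp add: Q_def E_def)
    next
      case (Suc l)
      define q where "q = d ^ l"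
      define T where "T = d ^ (N - 1)"
      have "(\<Sum>n=1..h. d ^ (m + n - 1)) = q * D"
        unfolding D_def q_def sum_distrib_left by (simp add: Suc power_add)
      moreover have "degree (Q 0) = q"
        using degree_orbit_poly_Suc[OF d, of x l] Suc by (simp add: Q_def q_def)
      ultimately have s: "(\<Sum>i\<in>{0..h}. degree (Q i)) = q + q * D" using sum by simp
      have "q * (2 + D) \<le> q * ((d - 1) * T)" using num unfolding T_def by (rule mult_left_mono) simp
      moreover have "d ^ (m + N - 1) = q * ((d - 1) * T) + q * T"
      proof -
        have "m + N - 1 = Suc (l + (N - 1))" using Suc N by simp
        then have "d ^ (m + N - 1) = d * (q * T)" by (simp only: power_Suc power_add q_def T_def)
        also have "\<dots> = ((d - 1) + 1) * (q * T)" using d by simp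
        finally show ?thesis by (simp add: algebra_simps)
      qed
      moreover have "d ^ (m + N - 2) = q * T"
      proof -
        have "m + N - 2 = l + (N - 1)" using Suc N by simp
        then show ?thesis by (simp only: power_add q_def T_def)
      qed
      moreover have "d ^ (m - 1) = q" by (simp add: Suc q_def)
      ultimately show ?thesis using cnt s by (simp add: algebra_simps)
    qed
  qed
  moreover have "Q i \<noteq> 0" for i
    using degree_orbit_poly_Suc[OF d, of x "m - 1"] d R0[of i] by (auto simp: Q_def simp del: orbit_poly.simps)
  ultimately obtain c where c: "poly (R N) c = 0" "\<forall>i\<in>{0..h}. poly (Q i) c \<noteq> 0"
    using exists_root_avoiding[of "{0..h}" Q "R N"] R0[OF N] unfolding k_def by auto
  have "poly (R n) c \<noteq> 0" if "n \<in> {1..h}" for n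
    using c(2) that by (auto simp: Q_def dest: bspec[of _ _ n])
  moreover have "m \<ge> 1 \<longrightarrow> poly (orbit_poly d x m) c \<noteq> 0"
    using c(2) by (auto simp: Q_def dest!: bspec[of _ _ 0])
  ultimately show ?thesis using c(1) by (auto simp: R_def h_def)
qed

lemma has_portrait_periodic:
  assumes N: "N \<ge> 1"
    and per: "poly (orbit_poly d x N) c = x"
    and small: "\<forall>n\<in>{1..N div 2}. poly (orbit_poly d x n) c \<noteq> x"
  shows "has_portrait (unicritical d c) x 0 N"
  using assms by (intro has_portraitI) (auto simp: poly_orbit_poly)

text \<open>
  The points at times \<open>m\<close> and \<open>m + N\<close> differ but have the same image, so periodicity starts at time
  \<open>m + 1\<close>. If the period dropped to a divisor \<open>n\<close> of \<open>N\<close>, the points at times \<open>m + n\<close> and \<open>m + N\<close> would be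
  equal, hence the same \<open>\<zeta>\<close> would occur in the coincidence for \<open>n\<close>.
\<close>
lemma has_portrait_strictly_preperiodic:
  fixes x :: "'a::idom"
  assumes N: "N \<ge> 1" and \<zeta>: "\<zeta> ^ d = 1" "\<zeta> \<noteq> 1"
    and co: "poly (orbit_poly d x (m + N)) c = \<zeta> * poly (orbit_poly d x m) c"
    and nz: "poly (orbit_poly d x m) c \<noteq> 0"
    and small: "\<forall>n\<in>{1..N div 2}. poly (orbit_poly d x (m + n)) c \<noteq> \<zeta> * poly (orbit_poly d x m) c"
  shows "has_portrait (unicritical d c) x (Suc m) N"
proof (rule has_portraitI[OF N])
  let ?f = "poly (unicritical d c)"
  note co = co[unfolded poly_orbit_poly] and small = small[unfolded poly_orbit_poly]
    and nz = nz[unfolded poly_orbit_poly]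
  show "(?f ^^ (Suc m + N)) x = (?f ^^ Suc m) x"
    using \<zeta> by (simp add: co poly_unicritical power_mult_distrib)
  show "(?f ^^ (Suc m + n)) x \<noteq> (?f ^^ Suc m) x" if n: "1 \<le> n" "n \<le> N div 2" "n dvd N" for n
  proof
    assume eq: "(?f ^^ (Suc m + n)) x = (?f ^^ Suc m) x"
    obtain k where k: "N = n * k" using n by (elim dvdE)
    then obtain j where j: "k = Suc j" using N by (cases k) auto
    have "m + N = (m + n) + j * n" using k j by (simp add: algebra_simps)
    moreover have "(?f ^^ ((m + n) + j * n)) x = (?f ^^ (m + n)) x"
      using n by (intro funpow_periodic_shift[OF eq]) simp
    ultimately have "(?f ^^ (m + n)) x = \<zeta> * (?f ^^ m) x" using co by metis
    then show False using small n by auto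
  qed
  show "(?f ^^ (l + N)) x \<noteq> (?f ^^ l) x" if "Suc m = Suc l" for l
    using that co nz \<zeta> by auto
qed

text \<open>
  A root of \<open>1 + z + \<dots> + z\<^bsup>d-1\<^esup>\<close>, whose value at \<open>1\<close> is \<open>d \<noteq> 0\<close>.
\<close>
lemma exists_root_of_unity:
  assumes "d \<ge> 2"
  shows "\<exists>\<zeta>::'a::{alg_closed_field, field_char_0}. \<zeta> ^ d = 1 \<and> \<zeta> \<noteq> 1"
proof -
  have "d = Suc (Suc (d - 2))" using assms by simp
  then obtain n where d: "d = Suc (Suc n)" ..
  obtain \<zeta> :: 'a where z: "(\<Sum>k\<le>Suc n. 1 * \<zeta> ^ k) = 0"
    using alg_closed[of "Suc n" "\<lambda>_. 1 :: 'a"] by auto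
  have "1 - \<zeta> ^ d = (1 - \<zeta>) * (\<Sum>k<d. \<zeta> ^ k)" by (rule one_diff_power_eq)
  also have "(\<Sum>k<d. \<zeta> ^ k) = 0" using z by (simp add: d lessThan_Suc_atMost)
  finally have "\<zeta> ^ d = 1" by simp
  moreover have "\<zeta> \<noteq> 1"
  proof
    assume "\<zeta> = 1"
    then have "of_nat (Suc (Suc n)) = (0::'a)" using z by simp
    then show False by (simp only: of_nat_eq_0_iff)
  qed
  ultimately show ?thesis by blast
qed

section \<open>Quadratic polynomials and periods one and two\<close>

lemma exists_other_root:
  fixes p :: "'a::alg_closed_field poly"
  assumes "degree p \<ge> 2" "poly p r = 0" "poly (pderiv p) r \<noteq> 0"
  shows "\<exists>z. poly p z = 0 \<and> z \<noteq> r"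
proof -
  obtain q where q: "p = [:-r, 1:] * q" using assms(2) by (auto simp: poly_eq_0_iff_dvd elim: dvdE)
  have "q \<noteq> 0" using assms q by auto
  then have "degree p = Suc (degree q)" unfolding q by (subst degree_mult_eq) auto
  then obtain z where z: "poly q z = 0" using assms alg_closed_imp_poly_has_root[of q] by auto
  have "poly (pderiv p) r = poly q r" unfolding q pderiv_mult by (simp add: pderiv_pCons)
  then show ?thesis using z assms q by (intro exI[of _ z]) auto
qed

text \<open>
  A root with \<open>P\<^sub>m(c) = 0\<close> has \<open>P\<^bsub>m+1\<^esub>(c) = c = 0\<close>, and the orbit of \<open>x\<close> under \<open>z\<^sup>2\<close> reaches \<open>0\<close> only from
  \<open>x = 0\<close>. In that case \<open>c = 0\<close> is a simple root, since the derivative there is \<open>2\<close>, and another root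
  exists.
\<close>
lemma exists_parameter_quadratic_fixed:
  fixes x :: "'a::{alg_closed_field, field_char_0}"
  assumes "m \<ge> 1"
  shows "\<exists>c. poly (orbit_poly 2 x (m + 1)) c = - poly (orbit_poly 2 x m) c
    \<and> poly (orbit_poly 2 x m) c \<noteq> 0"
proof -
  obtain l where l: "m = Suc l" using assms by (cases m) auto
  define R where "R = orbit_poly 2 x (Suc m) + orbit_poly 2 x m"
  have "degree R = 2 ^ m"
    using degree_orbit_poly_diff[of 2 1 x m "-1"] by (simp add: R_def del: orbit_poly.simps)
  then have degR: "degree R \<ge> 2" by (simp add: l)
  have at0: "poly (orbit_poly 2 x n) 0 = x ^ (2 ^ n)" for n
    by (induction n) (simp_all flip: power_mult add: mult.commute)
  have "\<exists>c. poly R c = 0 \<and> (x = 0 \<longrightarrow> c \<noteq> 0)"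
  proof (cases "x = 0")
    case True
    have "poly (pderiv (orbit_poly 2 x (Suc n))) 0 = 1" for n
      using at0[of n] True by (simp add: pderiv_add pderiv_power pderiv_pCons)
    then have "poly (pderiv R) 0 = 2" by (simp add: R_def l pderiv_add del: orbit_poly.simps)
    moreover have "poly R 0 = 0" using at0[of m] at0[of "Suc m"] True by (simp add: R_def power_0_left del: orbit_poly.simps)
    ultimately show ?thesis using exists_other_root[OF degR, of 0] by auto
  next
    case False
    then show ?thesis using alg_closed_imp_poly_has_root[of R] degR by auto
  qed
  then obtain c where c: "poly R c = 0" "x = 0 \<longrightarrow> c \<noteq> 0" by blast
  have "poly (orbit_poly 2 x m) c \<noteq> 0"
  proof
    assume u: "poly (orbit_poly 2 x m) c = 0"
    with c have "c = 0" by (simp add: R_def)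
    with u at0[of m] c show False by simp
  qed
  moreover have "poly (orbit_poly 2 x (m + 1)) c = - poly (orbit_poly 2 x m) c"
    using c by (simp add: R_def add_eq_0_iff2)
  ultimately show ?thesis by blast
qed

text \<open>
  From \<open>P\<^bsub>m+2\<^esub> + P\<^sub>m = (P\<^bsub>m+1\<^esub> + P\<^sub>m) (P\<^bsub>m+1\<^esub> - P\<^sub>m + 1)\<close>, the roots of the second factor are the
  candidates for eventual period two. Such a root is bad only if \<open>P\<^sub>m(c) = 0\<close>, which forces \<open>c = -1\<close>, or
  if \<open>P\<^sub>m(c) = 1/2\<close>, which forces \<open>c = -3/4\<close> and makes \<open>P\<^bsub>m+1\<^esub>(c) = -1/2\<close> a fixed point. For \<open>m \<ge> 2\<close> the
  factor is \<open>(P\<^sub>m - 1/2)\<^sup>2 + (c + 3/4)\<close>, to which the bound on distinct roots applies. It yields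
  at least \<open>2\<^bsup>m-1\<^esup>\<close> roots, so both bad values could only exhaust them for \<open>m = 2\<close>, where the two
  conditions on \<open>x\<close> are incompatible.
\<close>
lemma exists_parameter_quadratic_two_cycle:
  fixes x :: "'a::{alg_closed_field, field_char_0}"
  assumes "(x, m) \<notin> {(0, 0), (1 / 2, 0), (1, 1), (- 1, 1)}"
  shows "\<exists>c. poly (orbit_poly 2 x (m + 1)) c = poly (orbit_poly 2 x m) c - 1
    \<and> poly (orbit_poly 2 x m) c \<notin> {0, 1 / 2}"
proof -
  consider "m = 0" | "m = 1" | "m \<ge> 2" by linarith
  then show ?thesis
  proof cases
    case 1
    then show ?thesis using assms by (intro exI[of _ "x - 1 - x ^ 2"]) auto
  next
    case 2
    \<comment> \<open>In terms of \<open>u = P\<^sub>1 = x\<^sup>2 + c\<close> the equation reads \<open>u\<^sup>2 = x\<^sup>2 - 1\<close>.\<close>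
    have root: "\<exists>c. poly (orbit_poly 2 x (1 + 1)) c = poly (orbit_poly 2 x 1) c - 1
        \<and> poly (orbit_poly 2 x 1) c \<notin> {0, 1 / 2}"
      if "u ^ 2 = x ^ 2 - 1" "u \<notin> {0, 1 / 2}" for u
      using that by (intro exI[of _ "u - x ^ 2"]) auto
    obtain u where u: "u ^ 2 = x ^ 2 - 1" using nth_root_exists[of 2 "x ^ 2 - 1"] by auto
    have "u \<noteq> 0"
    proof
      assume "u = 0"
      then have "x ^ 2 = 1" using u by simp
      then show False using assms 2 by (auto simp: power2_eq_1_iff)
    qed
    then have "u \<notin> {0, 1 / 2} \<or> - u \<notin> {0, 1 / 2}" by auto
    then show ?thesis using root[of u] root[of "- u"] u 2 by auto
  next
    case 3
    then have "m = Suc (Suc (m - 2))" by simp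
    then obtain l where l: "m = Suc (Suc l)" ..
    define A where "A = orbit_poly 2 x m - [:1 / 2:]"
    define Z where "Z = {c. poly (A ^ 2 + [:3 / 4, 1:]) c = 0}"
    have degA: "degree A = 2 ^ Suc l"
    proof -
      have "degree [:- 1 / 2 :: 'a:] < degree (orbit_poly 2 x m)"
        using degree_orbit_poly_Suc[of 2 x "Suc l"] l by (simp del: orbit_poly.simps)
      then show ?thesis
        using degree_orbit_poly_Suc[of 2 x "Suc l"] l unfolding A_def
        by (simp add: degree_add_eq_left diff_conv_add_uminus del: orbit_poly.simps add_uminus_conv_diff)
    qed
    then have "2 * degree A + 1 \<le> card Z + degree [:3 / 4, 1 :: 'a:] + degree A"
      unfolding Z_def by (intro card_roots_power_add_ge) (auto intro!: Suc_lessI)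
    then have card: "2 * 2 ^ l \<le> card Z" using degA by simp
    have Z: "poly (orbit_poly 2 x (m + 1)) c = poly (orbit_poly 2 x m) c - 1" if "c \<in> Z" for c
      using that by (simp add: Z_def A_def power2_eq_square field_simps) algebra
    show ?thesis
    proof (rule ccontr)
      assume contra: "\<not> ?thesis"
      have bad: "c = -1 \<and> poly (orbit_poly 2 x m) c = 0
          \<or> c = - (3 / 4) \<and> poly (orbit_poly 2 x m) c = 1 / 2" if "c \<in> Z" for c
      proof -
        have "poly (orbit_poly 2 x m) c = 0 \<or> poly (orbit_poly 2 x m) c = 1 / 2"
          using contra Z[OF that] by auto
        moreover have "c = poly (orbit_poly 2 x m) c - 1 - poly (orbit_poly 2 x m) c ^ 2"
          using Z[OF that] by (simp add: algebra_simps)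
        ultimately show ?thesis by (elim disjE) (simp_all add: power2_eq_square)
      qed
      have sub: "Z \<subseteq> {-1, - (3 / 4)}" using bad by auto
      then have "card Z \<le> card {-1, - (3 / 4) :: 'a}" by (intro card_mono) auto
      also have le2: "\<dots> \<le> 2" by (rule order.trans[OF card_insert_le_m1]) auto
      finally have cZ: "card Z \<le> 2" .
      have "l = 0"
      proof (rule ccontr)
        assume "l \<noteq> 0"
        then have "(2::nat) ^ 1 \<le> 2 ^ l" by (intro power_increasing) auto
        then show False using cZ card by simp
      qed
      then have "card {-1, - (3 / 4) :: 'a} \<le> card Z" using card le2 by simp
      then have "Z = {-1, - (3 / 4)}" using sub by (intro card_seteq) auto
      then have "poly (orbit_poly 2 x m) (-1) = 0" "poly (orbit_poly 2 x m) (- (3 / 4)) = 1 / 2"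
        using bad[of "-1"] bad[of "- (3 / 4)"] by auto
      moreover define y where "y = x ^ 2"
      moreover have "m = Suc (Suc 0)" using l \<open>l = 0\<close> by simp
      ultimately have e: "(y - 1) ^ 2 = 1" "(y - 3 / 4) ^ 2 = 5 / 4"
        by (simp_all add: field_simps y_def)
      have "(4 * y - 3) ^ 2 = 16 * (y - 3 / 4) ^ 2"
        by (simp add: power2_eq_square algebra_simps)
      then have "(4 * y - 3) ^ 2 = 20" by (simp add: e)
      then have e2: "16 * (y * y) = 24 * y + 11"
        by (simp add: power2_eq_square algebra_simps)
      have e1: "y * y = 2 * y" using e(1) by (simp add: power2_eq_square algebra_simps)
      have y: "8 * y = 11" using e2 unfolding e1 by (simp add: algebra_simps)
      have "(8 * y) * (8 * y) = 64 * (y * y)" by simp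
      also have "\<dots> = 16 * (8 * y)" unfolding e1 by simp
      finally have "(8 * y) * (8 * y) = 16 * (8 * y)" .
      then show False unfolding y by simp
    qed
  qed
qed

section \<open>The exceptional cases\<close>

lemma not_has_portrait_zero_one:
  fixes c :: "'a::idom"
  assumes "d \<ge> 1" "N \<ge> 1"
  shows "\<not> has_portrait (unicritical d c) 0 1 N"
proof
  let ?f = "poly (unicritical d c)"
  assume h: "has_portrait (unicritical d c) 0 1 N"
  have "(?f ^^ N) 0 ^ d + c = c"
    using has_portraitD(1)[OF h] assms by (simp add: poly_unicritical)
  then have "(?f ^^ (0 + N)) 0 = (?f ^^ 0) 0" by simp
  from has_portraitD(2)[OF h assms(2) this] show False by simp
qed

text \<open>
  For \<open>x = -1/2\<close> the equation \<open>f\<^sup>2(x) = x\<close>, and for \<open>x = 1/2\<close> the equation \<open>f\<^sup>2(x) = -x\<close>, reads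
  \<open>(c + 3/4)\<^sup>2 = 0\<close>; at \<open>c = -3/4\<close> the point \<open>-1/2\<close> is fixed. For \<open>x = \<plusminus>1\<close> the equation \<open>f\<^sup>3(x) = -f(x)\<close> reads
  \<open>(f\<^sup>2(x) + f(x)) (1 + c)\<^sup>2 = 0\<close>. If the first factor vanishes, \<open>f\<^sup>2(x)\<close> is a fixed point; if \<open>c = -1\<close>, then
  \<open>f(x) = 0\<close> already lies on the cycle of \<open>0\<close> and \<open>-1\<close>.
\<close>
lemma not_has_portrait_quadratic:
  fixes x c :: "'a::field_char_0"
  assumes "(x, M) \<in> {(- (1 / 2), 0), (1 / 2, 1), (1, 2), (- 1, 2)}"
  shows "\<not> has_portrait (unicritical 2 c) x M 2"
proof
  define f where "f = poly (unicritical 2 c)"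
  assume h: "has_portrait (unicritical 2 c) x M 2"
  have f: "f z = z ^ 2 + c" for z by (simp add: f_def poly_unicritical)
  have per: "(f ^^ (M + 2)) x = (f ^^ M) x"
    using has_portraitD(1)[OF h] by (simp add: f_def)
  have no1: "(f ^^ (m + 1)) x \<noteq> (f ^^ m) x" for m
    using has_portraitD(2)[OF h, of 1 m] by (auto simp: f_def)
  have no2: "(f ^^ (m + 2)) x \<noteq> (f ^^ m) x" if "m < M" for m
    using has_portraitD(2)[OF h, of 2 m] that by (auto simp: f_def)
  have sq: "c = - (3 / 4)" if "(1 / 4 + c) ^ 2 + c + 1 / 2 = 0"
  proof -
    have "(c + 3 / 4) ^ 2 = 0" using that by (simp add: power2_eq_square field_simps)
    then show ?thesis by (simp add: eq_neg_iff_add_eq_0)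
  qed
  consider "x = - (1 / 2)" "M = 0" | "x = 1 / 2" "M = 1" | "x ^ 2 = 1" "M = 2"
    using assms by auto
  then show False
  proof cases
    case 1
    have "c = - (3 / 4)"
      using per 1 by (intro sq) (simp add: f eval_nat_numeral add.assoc)
    then show False using no1[of 0] 1 by (simp add: f power2_eq_square)
  next
    case 2
    define y where "y = (1 / 4 + c) ^ 2 + c"
    have "y ^ 2 = (1 / 2) ^ 2"
      using per 2 by (simp add: f y_def eval_nat_numeral)
    moreover have "y \<noteq> 1 / 2"
      using no2[of 0] 2 by (simp add: f y_def eval_nat_numeral)
    ultimately have "y = - (1 / 2)" by (simp only: power2_eq_iff) auto
    then have "c = - (3 / 4)" by (intro sq) (simp add: y_def)
    then show False using no1[of 1] 2 by (simp add: f power2_eq_square)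
  next
    case 3
    define y where "y = (1 + c) ^ 2 + c"
    have it: "(f ^^ 1) x = 1 + c" "(f ^^ 2) x = y" "(f ^^ 3) x = y ^ 2 + c"
      using 3 by (simp_all add: f y_def eval_nat_numeral)
    have "(f ^^ 4) x = (y ^ 2 + c) ^ 2 + c"
      using it(3) by (simp add: f eval_nat_numeral)
    moreover have "y = (1 + c) ^ 2 + c" by (simp add: y_def)
    ultimately have "(y ^ 2 + c) ^ 2 = (1 + c) ^ 2" using per 3 it by simp
    moreover have it13: "y ^ 2 + c \<noteq> 1 + c"
    proof -
      have "(f ^^ (1 + 2)) x \<noteq> (f ^^ 1) x" using 3 by (intro no2) simp
      moreover have "1 + 2 = (3 :: nat)" by simp
      ultimately show ?thesis using it by metis
    qed
    ultimately have "y ^ 2 + c = - (1 + c)" by (simp only: power2_eq_iff) auto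
    then have "(y + (1 + c)) * (1 + c) ^ 2 = 0" unfolding y_def by algebra
    moreover have "y + (1 + c) \<noteq> 0"
    proof
      assume "y + (1 + c) = 0"
      then have "y ^ 2 + c = y" unfolding y_def by algebra
      then have "(f ^^ 3) x = (f ^^ 2) x" using it by simp
      then show False using no1[of 2] by simp
    qed
    ultimately have "c = - 1" by (simp add: eq_neg_iff_add_eq_0 add.commute)
    then show False using it13 by (simp add: y_def)
  qed
qed

section \<open>The classification\<close>

theorem theorem1p3:
  fixes x :: "'a::{alg_closed_field, field_char_0}"
    and M N d :: nat
  assumes "N \<ge> 1" and "d \<ge> 2"
  shows "(\<exists>c. has_portrait (unicritical d c) x M N) \<longleftrightarrow>
           (x, M) \<noteq> (0, 1) \<and>
           (x, M, N, d) \<notin>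
             {(- (1 / 2), 0, 2, 2), (1 / 2, 1, 2, 2), (1, 2, 2, 2), (- 1, 2, 2, 2)}"
proof
  assume "\<exists>c. has_portrait (unicritical d c) x M N"
  then obtain c where c: "has_portrait (unicritical d c) x M N" ..
  have "(x, M) \<noteq> (0, 1)"
    using c not_has_portrait_zero_one[of d N c] assms by auto
  moreover have "\<not> ((x, M) \<in> {(- (1 / 2), 0), (1 / 2, 1), (1, 2), (- 1, 2)} \<and> N = 2 \<and> d = 2)"
  proof
    assume ex: "(x, M) \<in> {(- (1 / 2), 0), (1 / 2, 1), (1, 2), (- 1, 2)} \<and> N = 2 \<and> d = 2"
    then have "\<not> has_portrait (unicritical d c) x M N"
      using not_has_portrait_quadratic[of x M c] by simp
    with c show False by contradiction
  qed
  ultimately show "(x, M) \<noteq> (0, 1) \<and>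
      (x, M, N, d) \<notin>
        {(- (1 / 2), 0, 2, 2), (1 / 2, 1, 2, 2), (1, 2, 2, 2), (- 1, 2, 2, 2)}"
    by blast
next
  assume nex: "(x, M) \<noteq> (0, 1) \<and>
      (x, M, N, d) \<notin>
        {(- (1 / 2), 0, 2, 2), (1 / 2, 1, 2, 2), (1, 2, 2, 2), (- 1, 2, 2, 2)}"
  show "\<exists>c. has_portrait (unicritical d c) x M N"
  proof (cases M)
    case 0
    show ?thesis
    proof (cases "d = 2 \<and> N = 2")
      case True
      \<comment> \<open>The root of \<open>(P\<^sub>2 - x) / (P\<^sub>1 - x) = c + x\<^sup>2 + x + 1\<close>.\<close>
      define c where "c = - (x ^ 2) - x - 1"
      have "x \<noteq> - x - 1"
      proof
        assume "x = - x - 1"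
        then have "2 * x = - 1" by algebra
        then have "x = - (1 / 2)" by (simp add: field_simps)
        then show False using nex 0 True by auto
      qed
      moreover have "poly (orbit_poly d x 1) c = - x - 1" using True by (simp add: c_def)
      moreover have "poly (orbit_poly d x 2) c = x"
      proof -
        have "poly (orbit_poly 2 x (1 + 1)) c = poly (orbit_poly 2 x 1) c ^ 2 + c" by simp
        then have "poly (orbit_poly 2 x 2) c = (- x - 1) ^ 2 + c"
          using calculation(2) True by (simp only: one_add_one)
        also have "\<dots> = x" by (simp add: c_def power2_eq_square algebra_simps)
        finally show ?thesis using True by simp
      qed
      ultimately show ?thesis
        unfolding 0 using True by (intro exI[of _ c] has_portrait_periodic) auto
    next
      case False
      then obtain c where "poly (orbit_poly d x (0 + N)) c = 1 * poly (orbit_poly d x 0) c"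
        "\<forall>n\<in>{1..N div 2}. poly (orbit_poly d x (0 + n)) c \<noteq> 1 * poly (orbit_poly d x 0) c"
        using exists_parameter[of d N 0 1 x] assms by fastforce
      then show ?thesis
        unfolding 0 using assms by (intro exI[of _ c] has_portrait_periodic) auto
    qed
  next
    case (Suc m)
    have x0: "m = 0 \<Longrightarrow> x \<noteq> 0" using nex Suc by auto
    consider "d \<ge> 3 \<or> N \<ge> 3 \<or> m = 0 \<and> N = 1" | "d = 2" "N = 1" "m \<ge> 1" | "d = 2" "N = 2"
      using assms by linarith
    then show ?thesis
    proof cases
      case 1
      obtain \<zeta> :: 'a where \<zeta>: "\<zeta> ^ d = 1" "\<zeta> \<noteq> 1"
        using exists_root_of_unity[OF assms(2)] by blast
      then have "\<zeta> \<noteq> 0" using assms by (auto simp: power_0_left)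
      then obtain c where c: "poly (orbit_poly d x (m + N)) c = \<zeta> * poly (orbit_poly d x m) c"
        "m \<ge> 1 \<longrightarrow> poly (orbit_poly d x m) c \<noteq> 0"
        "\<forall>n\<in>{1..N div 2}. poly (orbit_poly d x (m + n)) c \<noteq> \<zeta> * poly (orbit_poly d x m) c"
        using exists_parameter[OF assms(2,1) 1, of \<zeta> x] \<zeta> by blast
      have "poly (orbit_poly d x m) c \<noteq> 0" using c(2) x0 by (cases "m = 0") auto
      then show ?thesis unfolding Suc
        using has_portrait_strictly_preperiodic[OF assms(1) \<zeta> c(1) _ c(3)] by blast
    next
      case 2
      obtain c where c: "poly (orbit_poly 2 x (m + 1)) c = - 1 * poly (orbit_poly 2 x m) c"
        "poly (orbit_poly 2 x m) c \<noteq> 0"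
        using exists_parameter_quadratic_fixed[OF 2(3), of x] by auto
      have "has_portrait (unicritical 2 c) x (Suc m) 1"
        by (rule has_portrait_strictly_preperiodic[OF _ _ _ c]) auto
      then show ?thesis unfolding Suc 2 by blast
    next
      case 3
      have "(x, m) \<notin> {(0, 0), (1 / 2, 0), (1, 1), (- 1, 1)}"
        using nex Suc 3 by auto
      then obtain c where c: "poly (orbit_poly 2 x (m + 1)) c = poly (orbit_poly 2 x m) c - 1"
        "poly (orbit_poly 2 x m) c \<notin> {0, 1 / 2}"
        using exists_parameter_quadratic_two_cycle by blast
      define u where "u = poly (orbit_poly 2 x m) c"
      have P1: "poly (orbit_poly 2 x (m + 1)) c = u - 1" using c by (simp add: u_def)
      then have "u ^ 2 + c = u - 1" by (simp add: u_def)
      then have "(u - 1) ^ 2 + c = - u" by algebra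
      then have P2: "poly (orbit_poly 2 x (m + 2)) c = - 1 * u" using P1 by simp
      have "u - 1 \<noteq> - 1 * u"
      proof
        assume "u - 1 = - 1 * u"
        then have "2 * u = 1" by algebra
        then have "u = 1 / 2" by (simp add: field_simps)
        then show False using c by (simp add: u_def)
      qed
      then have "has_portrait (unicritical 2 c) x (Suc m) 2"
        using P1 P2 c by (intro has_portrait_strictly_preperiodic[of 2 "- 1"]) (auto simp flip: u_def)
      then show ?thesis unfolding Suc 3 by blast
    qed
  qed
qed

end
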